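(* For every $(x,\theta)\in\mathbb{Z}\times[\gamma,0)$ the function $J$ satisfies the discounted optimality equation $$J(x,\theta)=\min_{a\in A(x)}\Big[e^{\theta r(x,a)}\sum_{x'\in X}J(x',\theta\beta)\,q(x'|x,a)\Big],$$ and for $x\ge 0$ the right-hand side equals $$\min_{a\in\{0,\ldots,x\}}\Big[e^{\theta a}\Big(\sum_{k=a-x}^{\infty}J(x-a+k,\theta\beta)q_k+\sum_{k=-\infty}^{a-x-1}q_k\Big)\Big].$$
   Context: Setting. $X=\mathbb{Z}$, $\beta\in(0,1)$ is a discount factor, $Z_1,Z_2,\ldots$ are i.i.d. integer-valued random variables with $\mathbb{P}(Z_n=k)=q_k$, $k\in\mathbb{Z}$; $Z$ denotes a generic copy. Standing assumptions: $\mathbb{E}Z^+<\infty$ (where $Z^+=\max\{Z,0\}$) and $\mathbb{P}(Z<0)>0$. Action sets: $A(x)=\{0,\ldots,x\}$ for $x\ge0$ and $A(x)=\{0\}$ for $x<0$; $D=\{(x,a):x\in X,a\in A(x)\}$; reward $r(x,a)=a$. A policy $\pi=(\pi_k)_{k\ge0}$ is a sequence of maps assigning to each history $(x_0,a_0,\ldots,x_{k-1},a_{k-1},x_k)$ with $(x_m,a_m)\in D$ an action in $A(x_k)$; $\Pi$ is the set of all policies. Under $\pi$ and $x_0=x$, $a_k=\pi_k(x_0,a_0,\ldots,x_k)$, and $x_{k+1}=x_k-a_k+Z_{k+1}$ if $x_k\ge0$, $x_{k+1}=x_k$ if $x_k<0$; the law and expectation are $\mathbb{P}_x^\pi,\mathbb{E}_x^\pi$.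 The transition probabilities are $q(y|x,a)=q_{y-x+a}$ for $x\ge0$ and $q(x|x,a)=1$ for $x<0$. Fix $\gamma<0$ and let $I=[\gamma,0)$. For $(x,\theta)\in X\times I$, $$J_\pi(x,\theta)=\mathbb{E}_x^\pi\exp\Big\{\theta\sum_{k=0}^\infty\beta^k r(x_k,a_k)\Big\},\qquad J(x,\theta)=\inf_{\pi\in\Pi}J_\pi(x,\theta).$$ *)

theory Defs
  imports "HOL-Probability.Probability"
begin

definition actions :: "int \<Rightarrow> int set" where
  "actions x = (if 0 \<le> x then {0..x} else {0})"

definition admissible :: "(int \<times> int) set" where
  "admissible = {(x, a). a \<in> actions x}"

definition reward :: "int \<Rightarrow> int \<Rightarrow> real" where
  "reward x a = real_of_int a"

text \<open>A history \<open>(x\<^sub>0, a\<^sub>0, \<dots>, x\<^sub>k\<^sub>-\<^sub>1, a\<^sub>k\<^sub>-\<^sub>1, x\<^sub>k)\<close> is encoded as the list of the \<open>k\<close> past pairs, oldest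
  first, together with the current state. The decision rule \<open>\<pi> k\<close> is constrained only on lists of
  length \<open>k\<close> of admissible pairs; its other values are never used.\<close>

type_synonym policy = "nat \<Rightarrow> (int \<times> int) list \<Rightarrow> int \<Rightarrow> int"

definition policies :: "policy set" where
  "policies = {\<pi>. \<forall>k h x. length h = k \<and> set h \<subseteq> admissible \<longrightarrow> \<pi> k h x \<in> actions x}"

text \<open>Evolution from \<open>x\<close> under \<open>\<pi>\<close> for a fixed realization \<open>z\<close> of the increments;
  \<open>z 0\<close> is never used.\<close>

primrec history :: "policy \<Rightarrow> int \<Rightarrow> (nat \<Rightarrow> int) \<Rightarrow> nat \<Rightarrow> (int \<times> int) list \<times> int" where
  "history \<pi> x z 0 = ([], x)"
| "history \<pi> x z (Suc k) =
     (let (h, y) = history \<pi> x z k; a = \<pi> k h y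
      in (h @ [(y, a)], if 0 \<le> y then y - a + z (Suc k) else y))"

definition state_at :: "policy \<Rightarrow> int \<Rightarrow> (nat \<Rightarrow> int) \<Rightarrow> nat \<Rightarrow> int" where
  "state_at \<pi> x z k = snd (history \<pi> x z k)"

definition action_at :: "policy \<Rightarrow> int \<Rightarrow> (nat \<Rightarrow> int) \<Rightarrow> nat \<Rightarrow> int" where
  "action_at \<pi> x z k = \<pi> k (fst (history \<pi> x z k)) (snd (history \<pi> x z k))"

definition trans_prob :: "(int \<Rightarrow> real) \<Rightarrow> int \<Rightarrow> int \<Rightarrow> int \<Rightarrow> real" where
  "trans_prob q y x a = (if 0 \<le> x then q (y - x + a) else if y = x then 1 else 0)"

text \<open>The law of the controlled process is realized on the probability space \<open>M\<close> carrying the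
  increments \<open>Z\<close>. For \<open>\<pi> \<in> policies\<close> and i.i.d. increments with integrable positive part, the
  discounted sum has nonnegative terms and converges almost surely, because
  \<open>a\<^sub>k \<le> x\<^sup>+ + Z\<^sub>1\<^sup>+ + \<dots> + Z\<^sub>k\<^sup>+\<close>; so the convention for divergent sums is irrelevant.\<close>

definition J_policy ::
  "'w measure \<Rightarrow> (nat \<Rightarrow> 'w \<Rightarrow> int) \<Rightarrow> real \<Rightarrow> policy \<Rightarrow> int \<Rightarrow> real \<Rightarrow> real" where
  "J_policy M Z \<beta> \<pi> x \<theta> =
     (\<integral>\<omega>. exp (\<theta> * (\<Sum>k. \<beta> ^ k *
          reward (state_at \<pi> x (\<lambda>n. Z n \<omega>) k) (action_at \<pi> x (\<lambda>n. Z n \<omega>) k))) \<partial>M)"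

definition J_opt :: "'w measure \<Rightarrow> (nat \<Rightarrow> 'w \<Rightarrow> int) \<Rightarrow> real \<Rightarrow> int \<Rightarrow> real \<Rightarrow> real" where
  "J_opt M Z \<beta> x \<theta> = (INF \<pi>\<in>policies. J_policy M Z \<beta> \<pi> x \<theta>)"

end

theory Submission
  imports Defs
begin

text \<open>
  Write \<open>J\<close> for the optimal value. The argument is the classical one-step decomposition. Under a
  policy \<open>\<pi>\<close> started in \<open>x \<ge> 0\<close>, the first action \<open>a\<close> is a deterministic function of \<open>x\<close>, and from
  time 1 on the process is governed by another policy, the continuation of \<open>\<pi>\<close>, started in
  \<open>x - a + Z\<^sub>1\<close> and driven by the shifted noise \<open>Z\<^sub>2, Z\<^sub>3, \<dots>\<close>. The discounted total satisfies
  \<open>S = a + \<beta> S'\<close>, with \<open>S'\<close> the total of the continuation; because the shifted noise is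
  independent of \<open>Z\<^sub>1\<close> and has the same law as the original one, Fubini's theorem gives
  \<open>J\<^sub>\<pi>(x, \<theta>) = exp (\<theta> a) * E J\<^sub>\<pi>\<^sub>'(x - a + Z\<^sub>1, \<theta> \<beta>)\<close>, where \<open>\<pi>'\<close> is the continuation
  (\<open>policy_value_step\<close>).

  Bounding the value of the continuation from below by \<open>J\<close> yields
  \<open>J(x, \<theta>) \<ge> min\<^sub>a exp (\<theta> a) * E J(x - a + Z\<^sub>1, \<theta> \<beta>)\<close>. For the opposite inequality, fix an
  action \<open>a\<close> and for each state \<open>y\<close> an \<open>\<epsilon>\<close>-optimal policy \<open>\<sigma> y\<close> for the parameter \<open>\<theta> \<beta>\<close>. Since
  policies see the whole history, there is a single policy that plays \<open>a\<close> first and then follows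
  \<open>\<sigma> y\<close> for the state \<open>y\<close> it has moved to (\<open>paste\<close>). Every choice of \<open>\<sigma>\<close> is measurable because
  the state space is countable. The value of the pasted policy exceeds
  \<open>exp (\<theta> a) * E J(x - a + Z\<^sub>1, \<theta> \<beta>)\<close> by at most \<open>exp (\<theta> a) * \<epsilon> \<le> \<epsilon>\<close>.

  The decomposition of \<open>S\<close> needs convergent series. This is where the integrability of the
  positive part of the increments enters: it makes \<open>\<Sum>\<^sub>k \<beta>\<^sup>k Z\<^sub>k\<^sup>+\<close> finite almost surely, and on that
  event the discounted actions are summable for every policy and every initial state
  simultaneously (\<open>summable_discounted_actions\<close>).

  The expectations turn into series over the integers because a bounded function has expectation
  \<open>\<Sum>\<^sub>k g(k) q\<^sub>k\<close>, and the second formula results from \<open>J = 1\<close> on the negative states, where all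
  actions are \<open>0\<close>.
\<close>

section \<open>Pathwise structure of the controlled process\<close>

text \<open>Increments act from index \<open>1\<close> on. A noise sequence \<open>w\<close> indexed from \<open>0\<close> is therefore fed into the
  process as \<open>case_nat 0 w\<close>, with a dummy head.\<close>

lemma history_cong:
  assumes "\<And>n. z (Suc n) = z' (Suc n)"
  shows "history \<pi> x z k = history \<pi> x z' k"
  by (induction k) (simp_all add: assms Let_def split: prod.split)

lemma state_at_0 [simp]: "state_at \<pi> x z 0 = x"
  by (simp add: state_at_def)

lemma state_at_Suc:
  "state_at \<pi> x z (Suc k) =
     (if 0 \<le> state_at \<pi> x z k then state_at \<pi> x z k - action_at \<pi> x z k + z (Suc k)
      else state_at \<pi> x z k)"
  by (simp add: state_at_def action_at_def Let_def split: prod.split)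

lemma zero_in_actions: "0 \<in> actions x"
  by (simp add: actions_def)

lemma finite_actions: "finite (actions x)"
  by (simp add: actions_def)

lemma actions_nonneg: "a \<in> actions x \<Longrightarrow> 0 \<le> a"
  by (auto simp: actions_def split: if_splits)

lemma policy_action:
  "\<pi> \<in> policies \<Longrightarrow> length h = k \<Longrightarrow> set h \<subseteq> admissible \<Longrightarrow> \<pi> k h x \<in> actions x"
  unfolding policies_def by blast

lemma history_admissible:
  assumes "\<pi> \<in> policies"
  shows "length (fst (history \<pi> x z k)) = k \<and> set (fst (history \<pi> x z k)) \<subseteq> admissible"
proof (induction k)
  case (Suc k)
  then have "\<pi> k (fst (history \<pi> x z k)) (snd (history \<pi> x z k))
      \<in> actions (snd (history \<pi> x z k))"
    using assms by (intro policy_action) auto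
  with Suc show ?case
    by (auto simp: Let_def admissible_def split: prod.splits)
qed simp

lemma action_at_in_actions:
  assumes "\<pi> \<in> policies"
  shows "action_at \<pi> x z k \<in> actions (state_at \<pi> x z k)"
  unfolding action_at_def state_at_def
  using history_admissible[OF assms, of x z k] assms by (intro policy_action) auto

lemma action_at_nonneg: "\<pi> \<in> policies \<Longrightarrow> 0 \<le> action_at \<pi> x z k"
  using action_at_in_actions actions_nonneg by blast

lemma action_at_le_state:
  "\<pi> \<in> policies \<Longrightarrow> action_at \<pi> x z k \<le> max (state_at \<pi> x z k) 0"
  using action_at_in_actions[of \<pi> x z k] by (auto simp: actions_def split: if_splits)

text \<open>Actions only lower the state, so the state is dominated by the starting point plus the positive
  parts of all increments so far, uniformly in the policy.\<close>

lemma state_at_le: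
  assumes "\<pi> \<in> policies"
  shows "max (state_at \<pi> x z k) 0 \<le> max x 0 + (\<Sum>i<k. max (z (Suc i)) 0)"
proof (induction k)
  case (Suc k)
  then show ?case
    using action_at_nonneg[OF assms, of x z k] by (auto simp: state_at_Suc)
qed simp

lemma absorbed_state:
  assumes "x < 0"
  shows "state_at \<pi> x z k = x"
  by (induction k) (use assms in \<open>simp_all add: state_at_Suc\<close>)

text \<open>The decisions of \<open>\<pi>\<close> from time 1 on, given that it started in \<open>x\<close>: the first state-action pair,
  which is determined by \<open>x\<close>, is prepended to the history.\<close>

definition continuation :: "policy \<Rightarrow> int \<Rightarrow> policy" where
  "continuation \<pi> x = (\<lambda>k h y. \<pi> (Suc k) ((x, \<pi> 0 [] x) # h) y)"

lemma initial_action: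
  assumes "\<pi> \<in> policies"
  shows "\<pi> 0 [] x \<in> actions x"
  using assms by (intro policy_action) auto

lemma continuation_in_policies:
  assumes "\<pi> \<in> policies"
  shows "continuation \<pi> x \<in> policies"
  unfolding policies_def continuation_def
proof (intro CollectI allI impI)
  fix k h y assume "length h = k \<and> set h \<subseteq> admissible"
  then show "\<pi> (Suc k) ((x, \<pi> 0 [] x) # h) y \<in> actions y"
    using initial_action[OF assms, of x] by (intro policy_action[OF assms]) (auto simp: admissible_def)
qed

text \<open>Pathwise Markov-type decomposition: the first increment \<open>y\<close> only shifts the starting point of
  the continuation, and the remaining increments \<open>w\<close> drive it.\<close>

lemma history_Suc_continuation:
  assumes "0 \<le> x"
  shows "history \<pi> x (case_nat c (case_nat y w)) (Suc k) =
    (let H = history (continuation \<pi> x) (x - \<pi> 0 [] x + y) (case_nat c w) k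
     in ((x, \<pi> 0 [] x) # fst H, snd H))"
proof (induction k)
  case 0
  then show ?case using assms by (simp add: Let_def)
next
  case (Suc k)
  show ?case
    by (subst history.simps(2), subst Suc)
      (simp add: Let_def continuation_def split: prod.split)
qed

lemma action_at_Suc_continuation:
  assumes "0 \<le> x"
  shows "action_at \<pi> x (case_nat c (case_nat y w)) (Suc k) =
    action_at (continuation \<pi> x) (x - \<pi> 0 [] x + y) (case_nat c w) k"
  unfolding action_at_def history_Suc_continuation[OF assms]
  by (simp add: Let_def continuation_def)

text \<open>Plays \<open>a\<close> in the initial state \<open>x\<close> and afterwards follows \<open>\<sigma> y\<close>, where \<open>y\<close> is the state at
  time 1. That state is the first component of the head of the history without its first pair,
  or the current state if only one step has been made; appending \<open>(y, 0)\<close> to the list treats both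
  cases at once, the \<open>0\<close> being a dummy. In initial states other than \<open>x\<close> the harmless action \<open>0\<close>
  makes the result an admissible policy.\<close>

definition paste :: "int \<Rightarrow> int \<Rightarrow> (int \<Rightarrow> policy) \<Rightarrow> policy" where
  "paste x a \<sigma> = (\<lambda>k h y. case h of
      [] \<Rightarrow> if y = x then a else 0
    | _ # h' \<Rightarrow> \<sigma> (fst (hd (h' @ [(y, 0)]))) (k - 1) h' y)"

lemma paste_initial [simp]: "paste x a \<sigma> 0 [] x = a"
  by (simp add: paste_def)

lemma paste_in_policies:
  assumes "a \<in> actions x" "\<And>y. \<sigma> y \<in> policies"
  shows "paste x a \<sigma> \<in> policies"
  unfolding policies_def
proof (intro CollectI allI impI)
  fix k h y assume "length h = k \<and> set h \<subseteq> admissible"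
  then show "paste x a \<sigma> k h y \<in> actions y"
    using assms zero_in_actions
    by (cases h) (auto simp: paste_def intro!: policy_action[OF assms(2)])
qed

lemma history_first_state: "fst (hd (fst (history \<pi> x z k) @ [(snd (history \<pi> x z k), b)])) = x"
proof (induction k)
  case (Suc k)
  then show ?case
    by (cases "fst (history \<pi> x z k)") (auto simp: Let_def split: prod.splits)
qed simp

text \<open>The continuation of the pasted policy agrees with \<open>\<sigma> y\<close> only on histories that begin in \<open>y\<close>;
  these are the ones that occur when the process starts in \<open>y\<close>.\<close>

lemma continuation_paste_along_history:
  "continuation (paste x a \<sigma>) x k (fst (history (\<sigma> y) y z k)) (snd (history (\<sigma> y) y z k))
    = \<sigma> y k (fst (history (\<sigma> y) y z k)) (snd (history (\<sigma> y) y z k))"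
  by (simp add: continuation_def paste_def history_first_state)

lemma history_continuation_paste:
  "history (continuation (paste x a \<sigma>) x) y z k = history (\<sigma> y) y z k"
proof (induction k)
  case (Suc k)
  then show ?case
    using continuation_paste_along_history[of x a \<sigma> k y z]
    by (cases "history (\<sigma> y) y z k") (simp add: Let_def)
qed simp

lemma action_at_continuation_paste:
  "action_at (continuation (paste x a \<sigma>) x) y z k = action_at (\<sigma> y) y z k"
  unfolding action_at_def history_continuation_paste continuation_paste_along_history ..

section \<open>Discounted totals\<close>

definition discounted_total :: "real \<Rightarrow> policy \<Rightarrow> int \<Rightarrow> (nat \<Rightarrow> int) \<Rightarrow> real" where
  "discounted_total \<beta> \<pi> x w = (\<Sum>k. \<beta> ^ k * real_of_int (action_at \<pi> x (case_nat 0 w) k))"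

text \<open>A condition on the noise alone, free of policy and initial state, under which all discounted
  totals converge.\<close>

definition tame :: "real \<Rightarrow> (nat \<Rightarrow> int) \<Rightarrow> bool" where
  "tame \<beta> w \<longleftrightarrow> summable (\<lambda>k. \<beta> ^ k * real_of_int (max (w k) 0))"

text \<open>The bound \<open>a\<^sub>k \<le> x\<^sup>+ + \<Sum>\<^sub>i\<^sub>\<le>\<^sub>k w\<^sub>i\<^sup>+\<close> leaves two series. One is geometric; the other,
  \<open>\<Sum>\<^sub>k \<beta>\<^sup>k \<Sum>\<^sub>i\<^sub>\<le>\<^sub>k w\<^sub>i\<^sup>+\<close>, is the Cauchy product of \<open>\<Sum>\<^sub>k \<beta>\<^sup>k w\<^sub>k\<^sup>+\<close> with the geometric series.\<close>

lemma summable_discounted_actions: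
  assumes "\<pi> \<in> policies" "0 < \<beta>" "\<beta> < 1" "tame \<beta> w"
  shows "summable (\<lambda>k. \<beta> ^ k * real_of_int (action_at \<pi> x (case_nat 0 w) k))"
proof (rule summable_comparison_test', rule summable_add)
  show "summable (\<lambda>k. real_of_int (max x 0) * \<beta> ^ k)"
    using assms by (intro summable_mult) (simp add: summable_geometric)
  have "summable (\<lambda>k. \<Sum>i\<le>k. (\<beta> ^ i * real_of_int (max (w i) 0)) * \<beta> ^ (k - i))"
    using assms by (intro summable_Cauchy_product) (simp_all add: tame_def abs_mult power_abs)
  moreover have "(\<Sum>i\<le>k. (\<beta> ^ i * real_of_int (max (w i) 0)) * \<beta> ^ (k - i))
      = \<beta> ^ k * real_of_int (\<Sum>i\<le>k. max (w i) 0)" for k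
  proof -
    have "(\<Sum>i\<le>k. (\<beta> ^ i * real_of_int (max (w i) 0)) * \<beta> ^ (k - i))
        = (\<Sum>i\<le>k. \<beta> ^ k * real_of_int (max (w i) 0))"
    proof (rule sum.cong[OF refl])
      fix i assume "i \<in> {..k}"
      then have "\<beta> ^ k = \<beta> ^ i * \<beta> ^ (k - i)" by (simp flip: power_add)
      then show "(\<beta> ^ i * real_of_int (max (w i) 0)) * \<beta> ^ (k - i)
          = \<beta> ^ k * real_of_int (max (w i) 0)" by simp
    qed
    then show ?thesis by (simp only: of_int_sum sum_distrib_left)
  qed
  ultimately show "summable (\<lambda>k. \<beta> ^ k * real_of_int (\<Sum>i\<le>k. max (w i) 0))"
    by simp
  fix k
  have "action_at \<pi> x (case_nat 0 w) k \<le> max x 0 + (\<Sum>i<k. max (w i) 0)"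
    using order.trans[OF action_at_le_state[OF assms(1)] state_at_le[OF assms(1)],
        of x "case_nat 0 w" k] by (simp only: nat.case)
  also have "(\<Sum>i<k. max (w i) 0) \<le> (\<Sum>i\<le>k. max (w i) 0)"
    by (rule sum_mono2) auto
  finally have "real_of_int (action_at \<pi> x (case_nat 0 w) k)
      \<le> real_of_int (max x 0 + (\<Sum>i\<le>k. max (w i) 0))"
    by (simp only: of_int_le_iff)
  then have "\<beta> ^ k * real_of_int (action_at \<pi> x (case_nat 0 w) k)
      \<le> \<beta> ^ k * real_of_int (max x 0 + (\<Sum>i\<le>k. max (w i) 0))"
    using assms by (intro mult_left_mono) auto
  then show "norm (\<beta> ^ k * real_of_int (action_at \<pi> x (case_nat 0 w) k))
      \<le> real_of_int (max x 0) * \<beta> ^ k + \<beta> ^ k * real_of_int (\<Sum>i\<le>k. max (w i) 0)"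
    using assms action_at_nonneg[OF assms(1), of x "case_nat 0 w" k]
    by (simp add: distrib_left mult.commute)
qed

lemma discounted_total_nonneg:
  assumes "\<pi> \<in> policies" "0 < \<beta>" "\<beta> < 1" "tame \<beta> w"
  shows "0 \<le> discounted_total \<beta> \<pi> x w"
  unfolding discounted_total_def
  using assms action_at_nonneg[OF assms(1)]
  by (intro suminf_nonneg summable_discounted_actions) auto

lemma tame_case_nat: "0 < \<beta> \<Longrightarrow> tame \<beta> (case_nat y w) \<longleftrightarrow> tame \<beta> w"
proof -
  assume "0 < \<beta>"
  have "tame \<beta> (case_nat y w) \<longleftrightarrow> summable (\<lambda>k. \<beta> * (\<beta> ^ k * real_of_int (max (w k) 0)))"
    unfolding tame_def by (subst summable_Suc_iff[symmetric]) (simp add: mult.assoc)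
  also have "\<dots> \<longleftrightarrow> tame \<beta> w"
    unfolding tame_def using \<open>0 < \<beta>\<close> by (subst summable_cmult_iff) simp
  finally show ?thesis .
qed

lemma discounted_total_step:
  assumes "\<pi> \<in> policies" "0 < \<beta>" "\<beta> < 1" "tame \<beta> w" "0 \<le> x"
  shows "discounted_total \<beta> \<pi> x (case_nat y w) = real_of_int (\<pi> 0 [] x) +
    \<beta> * discounted_total \<beta> (continuation \<pi> x) (x - \<pi> 0 [] x + y) w"
proof -
  let ?f = "\<lambda>k. \<beta> ^ k * real_of_int (action_at \<pi> x (case_nat 0 (case_nat y w)) k)"
  have "summable ?f"
    using assms by (intro summable_discounted_actions) (simp_all add: tame_case_nat)
  then have "suminf ?f = ?f 0 + (\<Sum>k. ?f (Suc k))"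
    using suminf_split_head[of ?f] by simp
  also have "(\<Sum>k. ?f (Suc k)) = (\<Sum>k. \<beta> * (\<beta> ^ k * real_of_int
      (action_at (continuation \<pi> x) (x - \<pi> 0 [] x + y) (case_nat 0 w) k)))"
    using assms(5) by (simp add: action_at_Suc_continuation mult.assoc)
  also have "\<dots> = \<beta> * discounted_total \<beta> (continuation \<pi> x) (x - \<pi> 0 [] x + y) w"
    unfolding discounted_total_def
    using assms by (intro suminf_mult summable_discounted_actions continuation_in_policies)
  finally show ?thesis
    by (simp add: discounted_total_def action_at_def)
qed

section \<open>The noise sequence\<close>

abbreviation noise :: "int pmf \<Rightarrow> (nat \<Rightarrow> int) measure" where
  "noise p \<equiv> \<Pi>\<^sub>M i\<in>(UNIV::nat set). measure_pmf p"

lemma prob_space_noise: "prob_space (noise p)"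
  by (intro prob_space_PiM prob_space_measure_pmf)

lemma measurable_noise_component [measurable]: "(\<lambda>w. w i) \<in> measurable (noise p) (count_space UNIV)"
proof -
  have "(\<lambda>w. w i) \<in> measurable (noise p) (measure_pmf p)"
    by (rule measurable_component_singleton) simp
  then show ?thesis by simp
qed

text \<open>A history depends on finitely many increments and takes values in a countable set, so it is
  measurable however irregular the policy is.\<close>

lemma measurable_history [measurable]:
  "(\<lambda>w. history \<pi> x (case_nat 0 w) k) \<in> measurable (noise p) (count_space UNIV)"
proof (induction k)
  case (Suc k)
  have "(\<lambda>w. (\<lambda>H v. let (h, y) = H; a = \<pi> k h y
         in (h @ [(y, a)], if 0 \<le> y then y - a + v else y)) (history \<pi> x (case_nat 0 w) k) (w k))
      \<in> measurable (noise p) (count_space UNIV)"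
    by (rule measurable_compose_countable[OF _ Suc],
        rule measurable_compose[OF measurable_noise_component]) simp
  then show ?case by (simp only: history.simps nat.case)
qed simp

lemma measurable_action_at [measurable]:
  "(\<lambda>w. action_at \<pi> x (case_nat 0 w) k) \<in> measurable (noise p) (count_space UNIV)"
  unfolding action_at_def
  by (rule measurable_compose[OF measurable_history]) simp

lemma measurable_discounted_total [measurable]:
  "discounted_total \<beta> \<pi> x \<in> borel_measurable (noise p)"
proof -
  have "(\<lambda>w. real_of_int (action_at \<pi> x (case_nat 0 w) k)) \<in> borel_measurable (noise p)" for k
    by (rule measurable_compose[OF measurable_action_at]) simp
  then show ?thesis
    unfolding discounted_total_def[abs_def] by measurable
qed

text \<open>The expectation of \<open>\<Sum>\<^sub>k \<beta>\<^sup>k w\<^sub>k\<^sup>+\<close> is \<open>\<Sum>\<^sub>k \<beta>\<^sup>k m < \<infinity>\<close>, where \<open>m\<close> is the mean of the positive part.\<close>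

lemma AE_tame:
  assumes "integrable (measure_pmf p) (\<lambda>k. real_of_int (max k 0))" "0 < \<beta>" "\<beta> < 1"
  shows "AE w in noise p. tame \<beta> w"
proof -
  define m where "m = measure_pmf.expectation p (\<lambda>k. real_of_int (max k 0))"
  have meas: "(\<lambda>w. real_of_int (max (w i) 0)) \<in> borel_measurable (noise p)" for i
    by (rule measurable_compose[OF measurable_noise_component]) simp
  have mean: "(\<integral>\<^sup>+w. ennreal (\<beta> ^ i * real_of_int (max (w i) 0)) \<partial>noise p) = ennreal (\<beta> ^ i * m)" for i
  proof -
    have "(\<integral>\<^sup>+w. ennreal (\<beta> ^ i * real_of_int (max (w i) 0)) \<partial>noise p)
        = (\<integral>\<^sup>+k. ennreal (\<beta> ^ i * real_of_int (max k 0)) \<partial>distr (noise p) (measure_pmf p) (\<lambda>w. w i))"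
      by (subst nn_integral_distr) (rule measurable_component_singleton, simp, simp, rule refl)
    also have "distr (noise p) (measure_pmf p) (\<lambda>w. w i) = measure_pmf p"
      by (rule distr_PiM_component) (simp_all add: prob_space_measure_pmf)
    also have "(\<integral>\<^sup>+k. ennreal (\<beta> ^ i * real_of_int (max k 0)) \<partial>measure_pmf p)
        = ennreal (measure_pmf.expectation p (\<lambda>k. \<beta> ^ i * real_of_int (max k 0)))"
      using assms by (intro nn_integral_eq_integral integrable_mult_right) auto
    finally show ?thesis by (simp add: m_def)
  qed
  have "0 \<le> m" unfolding m_def by (intro integral_nonneg_AE) simp
  have "(\<integral>\<^sup>+w. (\<Sum>i. ennreal (\<beta> ^ i * real_of_int (max (w i) 0))) \<partial>noise p)
      = (\<Sum>i. ennreal (\<beta> ^ i * m))"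
    using meas by (subst nn_integral_suminf) (simp_all add: mean)
  also have "\<dots> = ennreal (\<Sum>i. \<beta> ^ i * m)"
    using assms \<open>0 \<le> m\<close>
    by (intro suminf_ennreal2) (auto intro!: summable_mult2 summable_geometric)
  finally have "(\<integral>\<^sup>+w. (\<Sum>i. ennreal (\<beta> ^ i * real_of_int (max (w i) 0))) \<partial>noise p) \<noteq> \<infinity>"
    by simp
  then have "AE w in noise p. (\<Sum>i. ennreal (\<beta> ^ i * real_of_int (max (w i) 0))) \<noteq> \<infinity>"
    using meas by (intro nn_integral_PInf_AE) simp_all
  then show ?thesis
  proof eventually_elim
    case (elim w)
    then show ?case
      unfolding tame_def using assms
      by (intro summable_suminf_not_top) (auto simp: infinity_ennreal_def)
  qed
qed

section \<open>Expected values of policies\<close>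

locale discounted_noise =
  fixes p :: "int pmf" and \<beta> :: real
  assumes integrable_positive_part: "integrable (measure_pmf p) (\<lambda>k. real_of_int (max k 0))"
    and discount: "0 < \<beta>" "\<beta> < 1"
begin

definition policy_value :: "policy \<Rightarrow> int \<Rightarrow> real \<Rightarrow> real" where
  "policy_value \<pi> x \<theta> = (\<integral>w. exp (\<theta> * discounted_total \<beta> \<pi> x w) \<partial>noise p)"

definition optimal_value :: "int \<Rightarrow> real \<Rightarrow> real" where
  "optimal_value x \<theta> = (INF \<pi>\<in>policies. policy_value \<pi> x \<theta>)"

lemma AE_tame_noise: "AE w in noise p. tame \<beta> w"
  using AE_tame integrable_positive_part discount .

lemma measurable_exp_total [measurable]:
  "(\<lambda>w. exp (\<theta> * discounted_total \<beta> \<pi> x w)) \<in> borel_measurable (noise p)"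
  by measurable

lemma AE_exp_total_le_1:
  assumes "\<pi> \<in> policies" "\<theta> < 0"
  shows "AE w in noise p. exp (\<theta> * discounted_total \<beta> \<pi> x w) \<le> 1"
  using AE_tame_noise
proof eventually_elim
  case (elim w)
  then show ?case
    using discounted_total_nonneg[OF assms(1) discount elim, of x] assms(2)
    by (simp add: mult_le_0_iff)
qed

lemma integrable_exp_total:
  assumes "\<pi> \<in> policies" "\<theta> < 0"
  shows "integrable (noise p) (\<lambda>w. exp (\<theta> * discounted_total \<beta> \<pi> x w))"
proof -
  interpret prob_space "noise p" by (rule prob_space_noise)
  show ?thesis
    using AE_exp_total_le_1[OF assms] by (intro integrable_const_bound[where B = 1]) simp_all
qed

lemma policy_value_nonneg: "0 \<le> policy_value \<pi> x \<theta>"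
  unfolding policy_value_def by (intro integral_nonneg_AE) simp

lemma policy_value_le_1:
  assumes "\<pi> \<in> policies" "\<theta> < 0"
  shows "policy_value \<pi> x \<theta> \<le> 1"
proof -
  interpret prob_space "noise p" by (rule prob_space_noise)
  show ?thesis
    unfolding policy_value_def
    using AE_exp_total_le_1[OF assms] integrable_exp_total[OF assms]
    by (intro integral_le_const)
qed

lemma policy_value_negative:
  assumes "\<pi> \<in> policies" "x < 0"
  shows "policy_value \<pi> x \<theta> = 1"
proof -
  interpret prob_space "noise p" by (rule prob_space_noise)
  have "action_at \<pi> x z k = 0" for z k
    using action_at_in_actions[OF assms(1), of x z k] assms(2)
    by (simp add: absorbed_state actions_def)
  then show ?thesis
    by (simp add: policy_value_def discounted_total_def prob_space)
qed

text \<open>Prepending an independent increment to the noise sequence reproduces its law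
  (\<open>PiM_iter\<close>). Conditionally on that increment the discounted total decomposes into the first
  action and the total of the continuation, and Fubini's theorem separates the two integrations.\<close>

lemma policy_value_step:
  assumes "\<pi> \<in> policies" "\<theta> < 0" "0 \<le> x"
  shows "policy_value \<pi> x \<theta> = exp (\<theta> * real_of_int (\<pi> 0 [] x)) *
    measure_pmf.expectation p
      (\<lambda>y. policy_value (continuation \<pi> x) (x - \<pi> 0 [] x + y) (\<theta> * \<beta>))"
proof -
  interpret N: prob_space "noise p" by (rule prob_space_noise)
  interpret S: sequence_space "measure_pmf p" by unfold_locales
  interpret P: pair_prob_space "measure_pmf p" "noise p" by unfold_locales
  let ?f = "\<lambda>w. exp (\<theta> * discounted_total \<beta> \<pi> x w)"
  have prepend: "(\<lambda>(y, w). case_nat y w) \<in> measurable (measure_pmf p \<Otimes>\<^sub>M noise p) (noise p)"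
    by measurable
  have prepend_const: "(\<lambda>w. case_nat y w) \<in> measurable (noise p) (noise p)" for y
    using measurable_compose[OF measurable_Pair1' prepend, of y] by simp
  have "integrable (distr (measure_pmf p \<Otimes>\<^sub>M noise p) (noise p) (\<lambda>(y, w). case_nat y w)) ?f"
    unfolding S.PiM_iter by (rule integrable_exp_total[OF assms(1,2)])
  then have int: "integrable (measure_pmf p \<Otimes>\<^sub>M noise p) (\<lambda>yw. ?f (case yw of (y, w) \<Rightarrow> case_nat y w))"
    by (rule integrable_distr[OF prepend])
  have inner: "(\<integral>w. ?f (case_nat y w) \<partial>noise p) = exp (\<theta> * real_of_int (\<pi> 0 [] x)) *
      policy_value (continuation \<pi> x) (x - \<pi> 0 [] x + y) (\<theta> * \<beta>)" for y
  proof -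
    have "AE w in noise p. ?f (case_nat y w) = exp (\<theta> * real_of_int (\<pi> 0 [] x)) *
        exp (\<theta> * \<beta> * discounted_total \<beta> (continuation \<pi> x) (x - \<pi> 0 [] x + y) w)"
      using AE_tame_noise
    proof eventually_elim
      case (elim w)
      show ?case
        unfolding discounted_total_step[OF assms(1) discount elim assms(3)]
        by (simp add: distrib_left exp_add mult.assoc)
    qed
    then have "(\<integral>w. ?f (case_nat y w) \<partial>noise p) = (\<integral>w. exp (\<theta> * real_of_int (\<pi> 0 [] x)) *
        exp (\<theta> * \<beta> * discounted_total \<beta> (continuation \<pi> x) (x - \<pi> 0 [] x + y) w) \<partial>noise p)"
      using measurable_compose[OF prepend_const measurable_exp_total]
      by (intro integral_cong_AE) simp_all
    then show ?thesis by (simp add: policy_value_def)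
  qed
  have "policy_value \<pi> x \<theta>
      = integral\<^sup>L (distr (measure_pmf p \<Otimes>\<^sub>M noise p) (noise p) (\<lambda>(y, w). case_nat y w)) ?f"
    unfolding S.PiM_iter policy_value_def ..
  also have "\<dots> = (\<integral>yw. ?f (case yw of (y, w) \<Rightarrow> case_nat y w) \<partial>(measure_pmf p \<Otimes>\<^sub>M noise p))"
    by (rule integral_distr[OF prepend measurable_exp_total])
  also have "\<dots> = (\<integral>y. (\<integral>w. ?f (case_nat y w) \<partial>noise p) \<partial>measure_pmf p)"
    using P.integral_fst'[OF int] by simp
  finally show ?thesis by (simp add: inner)
qed

section \<open>The optimality equation\<close>

lemma policies_nonempty: "policies \<noteq> {}"
proof -
  have "(\<lambda>_ _ _. 0) \<in> policies" by (simp add: policies_def zero_in_actions)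
  then show ?thesis by blast
qed

lemma optimal_value_le: "\<pi> \<in> policies \<Longrightarrow> optimal_value x \<theta> \<le> policy_value \<pi> x \<theta>"
  unfolding optimal_value_def
  by (intro cINF_lower bdd_belowI2[where m = 0] policy_value_nonneg)

lemma optimal_value_nonneg: "0 \<le> optimal_value x \<theta>"
  unfolding optimal_value_def
  by (intro cINF_greatest policies_nonempty policy_value_nonneg)

lemma optimal_value_le_1: "\<theta> < 0 \<Longrightarrow> optimal_value x \<theta> \<le> 1"
  using policies_nonempty optimal_value_le policy_value_le_1 order.trans by (metis all_not_in_conv)

lemma optimal_value_negative: "x < 0 \<Longrightarrow> optimal_value x \<theta> = 1"
  unfolding optimal_value_def using policies_nonempty by (simp add: policy_value_negative)

lemma integrable_pmf_bounded:
  fixes g :: "int \<Rightarrow> real"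
  assumes "\<And>y. 0 \<le> g y" "\<And>y. g y \<le> 1"
  shows "integrable (measure_pmf p) g"
  using assms by (intro measure_pmf.integrable_const_bound[where B = 1]) auto

lemma integrable_optimal_value:
  "\<theta> < 0 \<Longrightarrow> integrable (measure_pmf p) (\<lambda>y. optimal_value (c + y) \<theta>)"
  by (intro integrable_pmf_bounded optimal_value_nonneg optimal_value_le_1)

text \<open>The expression minimised in the optimality equation, with the sum over successor states written
  as an expectation over the increment.\<close>

definition action_value :: "int \<Rightarrow> real \<Rightarrow> int \<Rightarrow> real" where
  "action_value x \<theta> a = exp (\<theta> * real_of_int a) *
     measure_pmf.expectation p (\<lambda>y. optimal_value (x - a + y) (\<theta> * \<beta>))"

lemma discounted_parameter_neg: "\<theta> < 0 \<Longrightarrow> \<theta> * \<beta> < 0"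
  using discount by (simp add: mult_neg_pos)

lemma action_value_le_policy_value:
  assumes "\<pi> \<in> policies" "\<theta> < 0" "0 \<le> x"
  shows "action_value x \<theta> (\<pi> 0 [] x) \<le> policy_value \<pi> x \<theta>"
  unfolding action_value_def policy_value_step[OF assms]
  using assms discounted_parameter_neg
  by (intro mult_left_mono integral_mono integrable_optimal_value integrable_pmf_bounded
      policy_value_nonneg policy_value_le_1 optimal_value_le continuation_in_policies) auto

text \<open>Choose \<open>e\<close>-optimal policies for the state reached after one step and paste them behind the
  action \<open>a\<close>. Since \<open>\<theta> a \<le> 0\<close>, the error \<open>e\<close> is not enlarged by the factor \<open>exp (\<theta> a)\<close>.\<close>

lemma optimal_value_le_action_value:
  assumes "\<theta> < 0" "0 \<le> x" "a \<in> actions x"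
  shows "optimal_value x \<theta> \<le> action_value x \<theta> a"
proof (rule field_le_epsilon)
  fix e :: real assume "0 < e"
  have neg: "\<theta> * \<beta> < 0" by (rule discounted_parameter_neg[OF assms(1)])
  have "\<exists>\<pi>\<in>policies. policy_value \<pi> y (\<theta> * \<beta>) < optimal_value y (\<theta> * \<beta>) + e" for y
    using policies_nonempty \<open>0 < e\<close> unfolding optimal_value_def
    by (subst cINF_less_iff[symmetric]) (auto intro!: bdd_belowI2[where m = 0] policy_value_nonneg)
  then obtain \<sigma> where \<sigma>: "\<And>y. \<sigma> y \<in> policies"
      "\<And>y. policy_value (\<sigma> y) y (\<theta> * \<beta>) < optimal_value y (\<theta> * \<beta>) + e"
    by metis
  define \<pi> where "\<pi> = paste x a \<sigma>"
  have \<pi>: "\<pi> \<in> policies"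
    unfolding \<pi>_def by (rule paste_in_policies[OF assms(3) \<sigma>(1)])
  have follow: "policy_value (continuation \<pi> x) y \<eta> = policy_value (\<sigma> y) y \<eta>" for y \<eta>
    by (simp add: policy_value_def discounted_total_def \<pi>_def action_at_continuation_paste)
  have int: "integrable (measure_pmf p)
      (\<lambda>y. policy_value (\<sigma> (x - a + y)) (x - a + y) (\<theta> * \<beta>))"
    using \<sigma>(1) neg by (intro integrable_pmf_bounded policy_value_nonneg policy_value_le_1)
  have "optimal_value x \<theta> \<le> policy_value \<pi> x \<theta>"
    by (rule optimal_value_le[OF \<pi>])
  also have "\<dots> = exp (\<theta> * real_of_int a) *
      measure_pmf.expectation p (\<lambda>y. policy_value (\<sigma> (x - a + y)) (x - a + y) (\<theta> * \<beta>))"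
    using policy_value_step[OF \<pi> assms(1,2)] unfolding follow by (simp add: \<pi>_def)
  also have "\<dots> \<le> exp (\<theta> * real_of_int a) *
      measure_pmf.expectation p (\<lambda>y. optimal_value (x - a + y) (\<theta> * \<beta>) + e)"
    using \<sigma> neg
    by (intro mult_left_mono integral_mono Bochner_Integration.integrable_add integrable_const
        integrable_optimal_value int)
      (auto intro: less_imp_le)
  also have "\<dots> = action_value x \<theta> a + exp (\<theta> * real_of_int a) * e"
    using integrable_optimal_value[OF neg]
    by (simp add: action_value_def distrib_left)
  also have "\<dots> \<le> action_value x \<theta> a + e"
    using assms actions_nonneg[OF assms(3)] \<open>0 < e\<close>
    by (simp add: mult_le_0_iff mult_left_le_one_le)
  finally show "optimal_value x \<theta> \<le> action_value x \<theta> a + e" .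
qed

lemma optimality_equation:
  assumes "\<theta> < 0" "0 \<le> x"
  shows "optimal_value x \<theta> = (MIN a\<in>actions x. action_value x \<theta> a)"
proof (rule antisym)
  have ne: "actions x \<noteq> {}" using zero_in_actions by blast
  show "optimal_value x \<theta> \<le> (MIN a\<in>actions x. action_value x \<theta> a)"
    using ne finite_actions optimal_value_le_action_value[OF assms] by (subst Min_ge_iff) auto
  show "(MIN a\<in>actions x. action_value x \<theta> a) \<le> optimal_value x \<theta>"
    unfolding optimal_value_def
  proof (rule cINF_greatest[OF policies_nonempty])
    fix \<pi> assume "\<pi> \<in> policies"
    then have "(MIN a\<in>actions x. action_value x \<theta> a) \<le> action_value x \<theta> (\<pi> 0 [] x)"
      using finite_actions initial_action by (intro Min_le) auto
    also have "\<dots> \<le> policy_value \<pi> x \<theta>"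
      using \<open>\<pi> \<in> policies\<close> assms by (rule action_value_le_policy_value)
    finally show "(MIN a\<in>actions x. action_value x \<theta> a) \<le> policy_value \<pi> x \<theta>" .
  qed
qed

end

section \<open>Expectations as series\<close>

lemma pmf_expectation_eq_infsum:
  fixes g :: "'a \<Rightarrow> real"
  assumes "\<And>y. \<bar>g y\<bar> \<le> B"
  shows "(\<lambda>k. g k * pmf p k) summable_on A"
    and "measure_pmf.expectation p g = (\<Sum>\<^sub>\<infinity>k. g k * pmf p k)"
proof -
  have B: "\<bar>pmf p k * g k\<bar> \<le> norm (B * pmf p k)" for k
    using mult_right_mono[OF order.trans[OF assms abs_ge_self], of "pmf p k"]
    by (simp add: abs_mult mult.commute)
  have abs: "Infinite_Set_Sum.abs_summable_on (\<lambda>k. pmf p k * g k) A" for A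
  proof (rule Infinite_Set_Sum.abs_summable_on_comparison_test)
    show "Infinite_Set_Sum.abs_summable_on (\<lambda>k. B * pmf p k) A"
      by (intro abs_summable_on_cmult_right pmf_abs_summable)
  qed (use B in simp)
  have "(\<lambda>k. norm (pmf p k * g k)) summable_on A"
    by (rule iffD2[OF abs_summable_equivalent abs])
  then show "(\<lambda>k. g k * pmf p k) summable_on A"
    by (subst mult.commute) (rule abs_summable_summable)
  show "measure_pmf.expectation p g = (\<Sum>\<^sub>\<infinity>k. g k * pmf p k)"
    unfolding pmf_expectation_eq_infsetsum infsetsum_infsum[OF abs] by (simp add: mult.commute)
qed

lemma law_is_pmf:
  fixes X :: "'w \<Rightarrow> int"
  assumes "prob_space M" "X \<in> measurable M (count_space UNIV)"
  shows "\<exists>p. distr M (count_space UNIV) X = measure_pmf p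
    \<and> (\<forall>k. pmf p k = measure M {\<omega> \<in> space M. X \<omega> = k})"
proof -
  interpret prob_space M by fact
  define N where "N = distr M (count_space UNIV) X"
  interpret N: prob_space N unfolding N_def by (rule prob_space_distr[OF assms(2)])
  have sets: "sets N = UNIV" by (simp add: N_def)
  have "emeasure N UNIV = (\<integral>\<^sup>+k. emeasure N {k} \<partial>count_space UNIV)"
    by (rule emeasure_countable_singleton) (simp_all add: sets)
  moreover have "emeasure N UNIV = 1"
    using N.emeasure_space_1 by (simp add: N_def)
  ultimately have "(\<integral>\<^sup>+k. ennreal (measure N {k}) \<partial>count_space UNIV) = 1"
    by (simp add: N.emeasure_eq_measure)
  then have p: "pmf (embed_pmf (\<lambda>k. measure N {k})) k = measure N {k}" for k
    by (intro pmf_embed_pmf) simp_all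
  have "N = measure_pmf (embed_pmf (\<lambda>k. measure N {k}))"
    by (rule measure_eqI_countable[of _ UNIV])
      (simp_all add: sets emeasure_pmf_single p N.emeasure_eq_measure)
  moreover have "measure N {k} = measure M {\<omega> \<in> space M. X \<omega> = k}" for k
    unfolding N_def using assms(2) by (subst measure_distr) (auto intro!: arg_cong[where f = "measure M"])
  ultimately show ?thesis unfolding N_def[symmetric] using p by metis
qed

text \<open>Independence identifies the joint law of \<open>Z\<^sub>1, Z\<^sub>2, \<dots>\<close> with a product indexed by \<open>{1..}\<close>; the
  index shift carries it to the product over all natural numbers.\<close>

lemma law_of_shifted_noise:
  fixes Z :: "nat \<Rightarrow> 'w \<Rightarrow> int"
  assumes "prob_space M"
    and "prob_space.indep_vars M (\<lambda>_. count_space UNIV) Z {1..}"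
    and "\<And>n. 1 \<le> n \<Longrightarrow> distr M (count_space UNIV) (Z n) = measure_pmf p"
  shows "(\<lambda>\<omega> n. Z (Suc n) \<omega>) \<in> measurable M (noise p)"
    and "distr M (noise p) (\<lambda>\<omega> n. Z (Suc n) \<omega>) = noise p"
proof -
  interpret prob_space M by fact
  have rv: "Z i \<in> measurable M (count_space UNIV)" if "i \<in> {1..}" for i
    using assms(2) that by (simp add: indep_vars_def2)
  let ?C = "\<Pi>\<^sub>M i\<in>{1..}. count_space (UNIV :: int set)" and ?P = "\<Pi>\<^sub>M i\<in>{1::nat..}. measure_pmf p"
  have sets: "sets ?C = sets ?P" by (intro sets_PiM_cong) simp_all
  have "distr M ?C (\<lambda>\<omega>. \<lambda>i\<in>{1..}. Z i \<omega>)
      = (\<Pi>\<^sub>M i\<in>{1..}. distr M (count_space UNIV) (Z i))"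
    using indep_vars_iff_distr_eq_PiM'[where M' = "\<lambda>_. count_space UNIV" and X = Z and I = "{1..}"]
      rv assms(2) by blast
  also have "\<dots> = ?P" using assms(3) by (intro PiM_cong) auto
  finally have law: "distr M ?C (\<lambda>\<omega>. \<lambda>i\<in>{1..}. Z i \<omega>) = ?P" .
  have restrict: "(\<lambda>\<omega>. \<lambda>i\<in>{1..}. Z i \<omega>) \<in> measurable M ?C"
    by (rule measurable_restrict) (rule rv)
  have shift: "(\<lambda>w n. w (Suc n)) \<in> measurable ?P (noise p)"
  proof (rule measurable_PiM_single')
    show "(\<lambda>w. w (Suc n)) \<in> measurable ?P (measure_pmf p)" for n
      by (rule measurable_component_singleton) simp
  qed simp
  have shiftC: "(\<lambda>w n. w (Suc n)) \<in> measurable ?C (noise p)"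
    using shift measurable_cong_sets[OF sets refl] by blast
  have comp: "(\<lambda>w n. w (Suc n)) \<circ> (\<lambda>\<omega>. \<lambda>i\<in>{1..}. Z i \<omega>) = (\<lambda>\<omega> n. Z (Suc n) \<omega>)"
    by (auto simp: fun_eq_iff)
  show "(\<lambda>\<omega> n. Z (Suc n) \<omega>) \<in> measurable M (noise p)"
    using measurable_comp[OF restrict shiftC] unfolding comp .
  have "distr ?P (noise p) (\<lambda>w. \<lambda>n\<in>UNIV. w (Suc n)) = noise p"
    by (rule distr_PiM_reindex) (auto simp: prob_space_measure_pmf)
  then show "distr M (noise p) (\<lambda>\<omega> n. Z (Suc n) \<omega>) = noise p"
    using distr_distr[OF shiftC restrict] unfolding law comp by (simp add: restrict_UNIV)
qed

text \<open>The value depends on the increments only through their joint law, so the abstract probability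
  space may be replaced by the space of sequences.\<close>

lemma J_opt_eq_optimal_value:
  fixes Z :: "nat \<Rightarrow> 'w \<Rightarrow> int"
  assumes "discounted_noise p \<beta>"
    and "(\<lambda>\<omega> n. Z (Suc n) \<omega>) \<in> measurable M (noise p)"
    and "distr M (noise p) (\<lambda>\<omega> n. Z (Suc n) \<omega>) = noise p"
  shows "J_opt M Z \<beta> x \<theta> = discounted_noise.optimal_value p \<beta> x \<theta>"
proof -
  interpret discounted_noise p \<beta> by fact
  have "J_policy M Z \<beta> \<pi> x \<theta> = policy_value \<pi> x \<theta>" for \<pi>
  proof -
    have "history \<pi> x (\<lambda>n. Z n \<omega>) k = history \<pi> x (case_nat 0 (\<lambda>n. Z (Suc n) \<omega>)) k" for \<omega> k
      by (rule history_cong) simp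
    then have "J_policy M Z \<beta> \<pi> x \<theta>
        = (\<integral>\<omega>. exp (\<theta> * discounted_total \<beta> \<pi> x (\<lambda>n. Z (Suc n) \<omega>)) \<partial>M)"
      by (simp add: J_policy_def discounted_total_def reward_def action_at_def)
    also have "\<dots> = integral\<^sup>L (distr M (noise p) (\<lambda>\<omega> n. Z (Suc n) \<omega>))
        (\<lambda>w. exp (\<theta> * discounted_total \<beta> \<pi> x w))"
      by (rule integral_distr[symmetric, OF assms(2) measurable_exp_total])
    finally show ?thesis by (simp add: assms(3) policy_value_def)
  qed
  then show ?thesis by (simp add: J_opt_def optimal_value_def)
qed

theorem theorem3p1:
  fixes M :: "'w measure" and Z :: "nat \<Rightarrow> 'w \<Rightarrow> int" and q :: "int \<Rightarrow> real"
    and \<beta> \<gamma> \<theta> :: real and x :: int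
  assumes "prob_space M"
    and "prob_space.indep_vars M (\<lambda>_. count_space UNIV) Z {1..}"
    and "\<And>n k. 1 \<le> n \<Longrightarrow> measure M {\<omega> \<in> space M. Z n \<omega> = k} = q k"
    and "integrable M (\<lambda>\<omega>. real_of_int (max (Z 1 \<omega>) 0))"
    and "0 < measure M {\<omega> \<in> space M. Z 1 \<omega> < 0}"
    and "0 < \<beta>" and "\<beta> < 1"
    and "\<gamma> < 0" and "\<theta> \<in> {\<gamma>..<0}"
  shows "J_opt M Z \<beta> x \<theta> =
      (MIN a\<in>actions x. exp (\<theta> * reward x a) *
         (\<Sum>\<^sub>\<infinity>x'. J_opt M Z \<beta> x' (\<theta> * \<beta>) * trans_prob q x' x a))
    \<and> (0 \<le> x \<longrightarrow>
      (MIN a\<in>actions x. exp (\<theta> * reward x a) *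
         (\<Sum>\<^sub>\<infinity>x'. J_opt M Z \<beta> x' (\<theta> * \<beta>) * trans_prob q x' x a))
      = (MIN a\<in>{0..x}. exp (\<theta> * real_of_int a) *
         ((\<Sum>\<^sub>\<infinity>k\<in>{a - x..}. J_opt M Z \<beta> (x - a + k) (\<theta> * \<beta>) * q k)
          + (\<Sum>\<^sub>\<infinity>k\<in>{..a - x - 1}. q k))))"
proof -
  have "\<theta> < 0" using assms(9) by simp
  interpret prob_space M by fact
  have rv: "Z n \<in> measurable M (count_space UNIV)" if "1 \<le> n" for n
    using assms(2) that by (simp add: indep_vars_def2)
  obtain p where p: "\<And>k. pmf p k = q k"
    and p1: "distr M (count_space UNIV) (Z 1) = measure_pmf p"
    using law_is_pmf[OF assms(1) rv[of 1]] assms(3)[of 1] by auto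
  have law: "distr M (count_space UNIV) (Z n) = measure_pmf p" if n: "1 \<le> n" for n
  proof -
    obtain p' where "distr M (count_space UNIV) (Z n) = measure_pmf p'" "\<And>k. pmf p' k = q k"
      using law_is_pmf[OF assms(1) rv[OF n]] assms(3)[OF n] by auto
    with p show ?thesis by (metis pmf_eqI)
  qed
  have "integrable (distr M (count_space UNIV) (Z 1)) (\<lambda>k. real_of_int (max k 0))"
    using assms(4) rv[of 1] by (subst integrable_distr_eq) simp_all
  then interpret discounted_noise p \<beta>
    using assms(6,7) unfolding p1 by unfold_locales
  have J: "J_opt M Z \<beta> y \<eta> = optimal_value y \<eta>" for y \<eta>
    using law_of_shifted_noise[OF assms(1,2) law]
    by (intro J_opt_eq_optimal_value discounted_noise_axioms)
  have neg: "\<theta> * \<beta> < 0" by (rule discounted_parameter_neg[OF \<open>\<theta> < 0\<close>])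
  have bound: "\<bar>optimal_value y (\<theta> * \<beta>)\<bar> \<le> 1" for y
    using optimal_value_nonneg optimal_value_le_1[OF neg] by simp
  have series: "measure_pmf.expectation p (\<lambda>k. optimal_value (x - a + k) (\<theta> * \<beta>))
      = (\<Sum>\<^sub>\<infinity>k. optimal_value (x - a + k) (\<theta> * \<beta>) * q k)" for a
    using pmf_expectation_eq_infsum(2)[of "\<lambda>k. optimal_value (x - a + k) (\<theta> * \<beta>)", OF bound, of p]
    by (simp add: p)
  have transition: "exp (\<theta> * reward x a) *
      (\<Sum>\<^sub>\<infinity>x'. J_opt M Z \<beta> x' (\<theta> * \<beta>) * trans_prob q x' x a) = action_value x \<theta> a"
    if "0 \<le> x" for a
  proof -
    have "(\<Sum>\<^sub>\<infinity>x'. optimal_value x' (\<theta> * \<beta>) * trans_prob q x' x a)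
        = (\<Sum>\<^sub>\<infinity>k. optimal_value (x - a + k) (\<theta> * \<beta>) * q k)"
      by (rule infsum_reindex_bij_witness[where i = "\<lambda>k. x - a + k" and j = "\<lambda>x'. x' - x + a"])
        (use that in \<open>auto simp: trans_prob_def algebra_simps\<close>)
    then show ?thesis by (simp add: J action_value_def series reward_def)
  qed
  have split: "exp (\<theta> * real_of_int a) *
      ((\<Sum>\<^sub>\<infinity>k\<in>{a - x..}. J_opt M Z \<beta> (x - a + k) (\<theta> * \<beta>) * q k)
        + (\<Sum>\<^sub>\<infinity>k\<in>{..a - x - 1}. q k)) = action_value x \<theta> a" for a
  proof -
    let ?g = "\<lambda>k. optimal_value (x - a + k) (\<theta> * \<beta>) * q k"
    have "?g summable_on A" for A
      using pmf_expectation_eq_infsum(1)[of "\<lambda>k. optimal_value (x - a + k) (\<theta> * \<beta>)", OF bound, of p]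
      by (simp add: p)
    then have "infsum ?g ({a - x..} \<union> {..a - x - 1}) = infsum ?g {a - x..} + infsum ?g {..a - x - 1}"
      by (intro infsum_Un_disjoint) auto
    moreover have "{a - x..} \<union> {..a - x - 1} = UNIV" by auto
    moreover have "infsum ?g {..a - x - 1} = infsum q {..a - x - 1}"
      by (rule infsum_cong) (simp add: optimal_value_negative)
    ultimately show ?thesis by (simp add: J action_value_def series)
  qed
  show ?thesis
  proof (cases "0 \<le> x")
    case True
    then have "actions x = {0..x}" by (simp add: actions_def)
    with True show ?thesis
      unfolding transition[OF True] split by (simp add: J optimality_equation[OF \<open>\<theta> < 0\<close>])
  next
    case False
    then have "(\<Sum>\<^sub>\<infinity>x'. optimal_value x' (\<theta> * \<beta>) * trans_prob q x' x 0)
        = (\<Sum>\<^sub>\<infinity>x'\<in>{x}. optimal_value x' (\<theta> * \<beta>) * trans_prob q x' x 0)"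
      by (intro infsum_cong_neutral) (auto simp: trans_prob_def)
    with False show ?thesis
      by (simp add: J actions_def reward_def trans_prob_def optimal_value_negative)
  qed
qed

end
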